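(* Let $V$ be a vector space over a field $\mathbb F$ with dimension $d+1$, $d\ge 0$. Let $A,A^*$ be a spin Leonard pair on $V$ and let $W,W^*$ be a balanced Boltzmann pair for $A,A^*$. Let $\{E_i\}_{i=0}^d$ be a standard ordering of the primitive idempotents of $A$, and let $E_i^*=(WW^*W)^{-1}E_i\,WW^*W$ for $0\le i\le d$. Let $f,\{\tau_i\}_{i=0}^d$ be the nonzero scalars in $\mathbb F$ with $\tau_0=1$ and $$W=f\sum_{i=0}^d\tau_iE_i,\qquad W^*=f\sum_{i=0}^d\tau_iE_i^*.$$ Then, with $\nu$, $\gamma$, $\{A_i\}_{i=0}^d$, $\{A_i^*\}_{i=0}^d$ as defined in the context, $\nu$ and $\gamma$ being nonzero, $$W=f\gamma\sum_{i=0}^d\tau_i^{-1}A_i,\qquad W^{-1}=\nu^{-1}f^{-1}\gamma^{-1}\sum_{i=0}^d\tau_iA_i,$$ $$W^*=f\gamma\sum_{i=0}^d\tau_i^{-1}A_i^*,\qquad (W^* )^{-1}=\nu^{-1}f^{-1}\gamma^{-1}\sum_{i=0}^d\tau_iA_i^*.$$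
   Context: A Leonard pair on $V$ is an ordered pair of linear maps $A,A^*:V\to V$ such that there is a basis of $V$ for which $A$ is irreducible tridiagonal and $A^*$ diagonal, and a basis for which $A^*$ is irreducible tridiagonal and $A$ diagonal (a tridiagonal matrix is irreducible if all its subdiagonal and superdiagonal entries are nonzero; $A^*$ is just a second map, not an adjoint). Each of $A,A^*$ is then diagonalizable with all eigenspaces of dimension one. The primitive idempotents of $A$ are the projections onto its eigenspaces; an ordering $\{E_i\}_{i=0}^d$ of them is standard if for $0\ne v_i\in E_iV$ the matrix representing $A^*$ with respect to $\{v_i\}_{i=0}^d$ is irreducible tridiagonal. $\langle A\rangle$ is the subalgebra of $\mathrm{End}(V)$ generated by $A$. A Boltzmann pair for $A,A^*$ is an ordered pair $W,W^*$ with $W\in\langle A\rangle$ and $W^*\in\langle A^*\rangle$ invertible and $WA^*W^{-1}=(W^* )^{-1}AW^*$; it is balanced if $WW^*W=W^*WW^*$. A Leonard pair is a spin Leonard pair if it has a Boltzmann pair. In the setting of the claim, the map $\sigma:Y\mapsto(WW^*W)^{-1}Y\,WW^*W$ is an involutive automorphism of $\mathrm{End}(V)$ swapping $A\leftrightarrow A^*$, $W\leftrightarrow W^*$, $E_i\leftrightarrow E_i^*$; in particular the $E_i^*$ are the primitive idempotents of $A^*$ in a standard order, and the scalars $f,\tau_i$ exist. $\nu\in\mathbb F$ is the nonzero scalar with $\nu E_0E_0^*E_0=E_0$ and $\nu E_0^*E_0E_0^*=E_0^*$. $\rho:\langle A\rangle\to\langle A^*\rangle$ is the unique linear map with $YE_0^*E_0=Y^\rho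 E_0$ for all $Y\in\langle A\rangle$, and $\rho^*:\langle A^*\rangle\to\langle A\rangle$ is the unique linear map with $ZE_0E_0^*=Z^{\rho^*}E_0^*$ for all $Z\in\langle A^*\rangle$. For $0\le i\le d$, $A_i=\nu(E_i^* )^{\rho^*}\in\langle A\rangle$ and $A_i^*=\nu(E_i)^\rho\in\langle A^*\rangle$. The scalar $\gamma$ is $\gamma=f^{-1}\mathrm{tr}(W^*E_0)$ (which equals $f^{-1}\mathrm{tr}(WE_0^* )$). *)

theory Defs
  imports Complex_Main "HOL-Library.FuncSet"
begin

text \<open>
  The vector space \<open>V\<close> is a whole type \<open>'v\<close> with scalar multiplication \<open>scale\<close>; elements of
  \<open>End(V)\<close> are functions \<open>'v \<Rightarrow> 'v\<close> that are linear for \<open>scale\<close>, with composition as product.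
  Bases and other families \<open>v\<^sub>0, \<dots>, v\<^sub>d\<close> are functions on \<open>nat\<close> of which only the values at
  \<open>i \<le> d\<close> matter. A map written with a star in the literature (such as \<open>A\<^sup>*\<close>) gets the suffix
  \<open>s\<close>; it is just a second map, not an adjoint.
\<close>

definition basis_seq ::
  "('f::field \<Rightarrow> 'v::ab_group_add \<Rightarrow> 'v) \<Rightarrow> nat \<Rightarrow> (nat \<Rightarrow> 'v) \<Rightarrow> bool" where
  "basis_seq scale d v \<longleftrightarrow>
     inj_on v {..d} \<and> \<not> module.dependent scale (v ` {..d}) \<and> module.span scale (v ` {..d}) = UNIV"

text \<open>\<open>T v\<^sub>j = \<Sum>\<^sub>i (matrix_wrt scale d v T i j) v\<^sub>i\<close> when \<open>v\<close> is a basis.\<close>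

definition matrix_wrt ::
  "('f::field \<Rightarrow> 'v::ab_group_add \<Rightarrow> 'v) \<Rightarrow> nat \<Rightarrow> (nat \<Rightarrow> 'v) \<Rightarrow> ('v \<Rightarrow> 'v) \<Rightarrow> nat \<Rightarrow> nat \<Rightarrow> 'f" where
  "matrix_wrt scale d v T i j = module.representation scale (v ` {..d}) (T (v j)) (v i)"

definition diagonal_matrix :: "nat \<Rightarrow> (nat \<Rightarrow> nat \<Rightarrow> 'f::field) \<Rightarrow> bool" where
  "diagonal_matrix d M \<longleftrightarrow> (\<forall>i\<le>d. \<forall>j\<le>d. i \<noteq> j \<longrightarrow> M i j = 0)"

definition irreducible_tridiagonal :: "nat \<Rightarrow> (nat \<Rightarrow> nat \<Rightarrow> 'f::field) \<Rightarrow> bool" where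
  "irreducible_tridiagonal d M \<longleftrightarrow>
     (\<forall>i\<le>d. \<forall>j\<le>d. (i + 1 < j \<or> j + 1 < i) \<longrightarrow> M i j = 0) \<and>
     (\<forall>i<d. M i (i + 1) \<noteq> 0 \<and> M (i + 1) i \<noteq> 0)"

definition leonard_pair ::
  "('f::field \<Rightarrow> 'v::ab_group_add \<Rightarrow> 'v) \<Rightarrow> nat \<Rightarrow> ('v \<Rightarrow> 'v) \<Rightarrow> ('v \<Rightarrow> 'v) \<Rightarrow> bool" where
  "leonard_pair scale d A As \<longleftrightarrow>
     Vector_Spaces.linear scale scale A \<and> Vector_Spaces.linear scale scale As \<and>
     (\<exists>v. basis_seq scale d v \<and> irreducible_tridiagonal d (matrix_wrt scale d v A) \<and>
          diagonal_matrix d (matrix_wrt scale d v As)) \<and>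
     (\<exists>v. basis_seq scale d v \<and> irreducible_tridiagonal d (matrix_wrt scale d v As) \<and>
          diagonal_matrix d (matrix_wrt scale d v A))"

definition eigenspace ::
  "('f::field \<Rightarrow> 'v::ab_group_add \<Rightarrow> 'v) \<Rightarrow> ('v \<Rightarrow> 'v) \<Rightarrow> 'f \<Rightarrow> 'v set" where
  "eigenspace scale A \<theta> = {v. A v = scale \<theta> v}"

text \<open>The projection onto a nonzero eigenspace along the other ones. This determines \<open>E\<close> from
  \<open>\<theta>\<close> when \<open>A\<close> is diagonalizable, as is the case for both members of a Leonard pair.\<close>

definition primitive_idempotent ::
  "('f::field \<Rightarrow> 'v::ab_group_add \<Rightarrow> 'v) \<Rightarrow> ('v \<Rightarrow> 'v) \<Rightarrow> ('v \<Rightarrow> 'v) \<Rightarrow> bool" where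
  "primitive_idempotent scale A E \<longleftrightarrow>
     Vector_Spaces.linear scale scale E \<and>
     (\<exists>\<theta>. eigenspace scale A \<theta> \<noteq> {0} \<and>
          (\<forall>v\<in>eigenspace scale A \<theta>. E v = v) \<and>
          (\<forall>\<mu>. \<mu> \<noteq> \<theta> \<longrightarrow> (\<forall>v\<in>eigenspace scale A \<mu>. E v = 0)))"

text \<open>For an ordering \<open>E\<close> of all primitive idempotents of a diagonalizable \<open>A\<close> with
  one-dimensional eigenspaces, any choice of \<open>v\<close> below is a basis.\<close>

definition standard_ordering ::
  "('f::field \<Rightarrow> 'v::ab_group_add \<Rightarrow> 'v) \<Rightarrow> nat \<Rightarrow> ('v \<Rightarrow> 'v) \<Rightarrow> ('v \<Rightarrow> 'v) \<Rightarrow> (nat \<Rightarrow> 'v \<Rightarrow> 'v) \<Rightarrow> bool" where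
  "standard_ordering scale d A As E \<longleftrightarrow>
     bij_betw E {..d} {P. primitive_idempotent scale A P} \<and>
     (\<forall>v. (\<forall>i\<le>d. v i \<noteq> 0 \<and> v i \<in> range (E i)) \<longrightarrow>
          irreducible_tridiagonal d (matrix_wrt scale d v As))"

inductive_set gen_subalgebra ::
  "('f::field \<Rightarrow> 'v::ab_group_add \<Rightarrow> 'v) \<Rightarrow> ('v \<Rightarrow> 'v) \<Rightarrow> ('v \<Rightarrow> 'v) set"
  for scale :: "'f::field \<Rightarrow> 'v::ab_group_add \<Rightarrow> 'v" and A :: "'v \<Rightarrow> 'v" where
  gen: "A \<in> gen_subalgebra scale A"
| one: "id \<in> gen_subalgebra scale A"
| add: "X \<in> gen_subalgebra scale A \<Longrightarrow> Y \<in> gen_subalgebra scale A \<Longrightarrow>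
          (\<lambda>v. X v + Y v) \<in> gen_subalgebra scale A"
| scale: "X \<in> gen_subalgebra scale A \<Longrightarrow> (\<lambda>v. scale c (X v)) \<in> gen_subalgebra scale A"
| mult: "X \<in> gen_subalgebra scale A \<Longrightarrow> Y \<in> gen_subalgebra scale A \<Longrightarrow>
          X \<circ> Y \<in> gen_subalgebra scale A"

definition boltzmann_pair ::
  "('f::field \<Rightarrow> 'v::ab_group_add \<Rightarrow> 'v) \<Rightarrow> ('v \<Rightarrow> 'v) \<Rightarrow> ('v \<Rightarrow> 'v) \<Rightarrow> ('v \<Rightarrow> 'v) \<Rightarrow> ('v \<Rightarrow> 'v) \<Rightarrow> bool" where
  "boltzmann_pair scale A As W Ws \<longleftrightarrow>
     W \<in> gen_subalgebra scale A \<and> Ws \<in> gen_subalgebra scale As \<and> bij W \<and> bij Ws \<and>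
     W \<circ> As \<circ> inv W = inv Ws \<circ> A \<circ> Ws"

definition balanced :: "('v \<Rightarrow> 'v) \<Rightarrow> ('v \<Rightarrow> 'v) \<Rightarrow> bool" where
  "balanced W Ws \<longleftrightarrow> W \<circ> Ws \<circ> W = Ws \<circ> W \<circ> Ws"

definition spin_leonard_pair ::
  "('f::field \<Rightarrow> 'v::ab_group_add \<Rightarrow> 'v) \<Rightarrow> nat \<Rightarrow> ('v \<Rightarrow> 'v) \<Rightarrow> ('v \<Rightarrow> 'v) \<Rightarrow> bool" where
  "spin_leonard_pair scale d A As \<longleftrightarrow>
     leonard_pair scale d A As \<and> (\<exists>W Ws. boltzmann_pair scale A As W Ws)"

text \<open>\<open>extend_basis {}\<close> is some basis of \<open>V\<close>; by \<open>lin_trace_eq\<close> below the choice is irrelevant.\<close>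

definition lin_trace ::
  "('f::field \<Rightarrow> 'v::ab_group_add \<Rightarrow> 'v) \<Rightarrow> ('v \<Rightarrow> 'v) \<Rightarrow> 'f" where
  "lin_trace scale T =
     (\<Sum>b\<in>vector_space.extend_basis scale {}.
        module.representation scale (vector_space.extend_basis scale {}) (T b) b)"

lemma (in vector_space) trace_sum_basis_indep:
  assumes T: "Vector_Spaces.linear scale scale T"
    and B: "independent B" "span B = UNIV" "finite B"
    and C: "independent C" "span C = UNIV" "finite C"
  shows "(\<Sum>b\<in>B. representation B (T b) b) = (\<Sum>c\<in>C. representation C (T c) c)"
proof -
  interpret T: Vector_Spaces.linear scale scale T by (rule T)
  have expand: "(\<Sum>c\<in>D. scale (representation D x c) c) = x"
    if "independent D" "span D = UNIV" "finite D" for D x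
    using sum_representation_eq[of D x D] that by auto
  have rep: "representation D (\<Sum>c\<in>E. scale (g c) (h c)) x
      = (\<Sum>c\<in>E. g c * representation D (h c) x)"
    if "independent D" "span D = UNIV" for D E g h x
    using that by (simp add: representation_sum representation_scale)
  have "(\<Sum>b\<in>B. representation B (T b) b)
      = (\<Sum>b\<in>B. \<Sum>c\<in>C. representation C b c * representation B (T c) b)"
  proof (rule sum.cong[OF refl])
    fix b
    have "T b = T (\<Sum>c\<in>C. scale (representation C b c) c)"
      by (simp add: expand[OF C])
    also have "\<dots> = (\<Sum>c\<in>C. scale (representation C b c) (T c))"
      by (simp add: T.sum T.scale)
    finally show "representation B (T b) b
        = (\<Sum>c\<in>C. representation C b c * representation B (T c) b)"
      using rep[OF B(1,2)] by simp
  qed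
  also have "\<dots> = (\<Sum>c\<in>C. \<Sum>b\<in>B. representation B (T c) b * representation C b c)"
    by (subst sum.swap) (simp add: mult.commute)
  also have "\<dots> = (\<Sum>c\<in>C. representation C (T c) c)"
  proof (rule sum.cong[OF refl])
    fix c
    show "(\<Sum>b\<in>B. representation B (T c) b * representation C b c) = representation C (T c) c"
      using rep[OF C(1,2), of "representation B (T c)" "\<lambda>b. b" B c] expand[OF B, of "T c"] by simp
  qed
  finally show ?thesis .
qed

lemma lin_trace_eq:
  assumes "vector_space scale" and T: "Vector_Spaces.linear scale scale T"
    and B: "\<not> module.dependent scale B" "module.span scale B = UNIV" "finite B"
  shows "lin_trace scale T = (\<Sum>b\<in>B. module.representation scale B (T b) b)"
proof -
  interpret vector_space scale by fact
  have C: "independent (extend_basis {})" "span (extend_basis {}) = UNIV"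
    using independent_extend_basis[of "{}"] span_extend_basis[of "{}"] by (simp_all add: dependent_def)
  have "finite (extend_basis {})"
    using independent_span_bound[OF B(3) C(1)] B(2) by auto
  then show ?thesis
    unfolding lin_trace_def using trace_sum_basis_indep[OF T] B C by blast
qed

text \<open>Here \<open>P\<close> and \<open>Ps\<close> stand for \<open>E\<^sub>0\<close> and \<open>E\<^sub>0\<^sup>*\<close>.\<close>

definition nu_scalar ::
  "('f::field \<Rightarrow> 'v::ab_group_add \<Rightarrow> 'v) \<Rightarrow> ('v \<Rightarrow> 'v) \<Rightarrow> ('v \<Rightarrow> 'v) \<Rightarrow> 'f" where
  "nu_scalar scale P Ps =
     (THE c. c \<noteq> 0 \<and> (\<lambda>v. scale c ((P \<circ> Ps \<circ> P) v)) = P \<and> (\<lambda>v. scale c ((Ps \<circ> P \<circ> Ps) v)) = Ps)"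

text \<open>The unique linear map \<open>\<rho>: \<langle>A\<rangle> \<rightarrow> \<langle>B\<rangle>\<close> with \<open>Y Q P = \<rho>(Y) P\<close> for all \<open>Y \<in> \<langle>A\<rangle>\<close>. Taking the function
  space \<open>\<rightarrow>\<^sub>E\<close> fixes the irrelevant values outside \<open>\<langle>A\<rangle>\<close>, so that uniqueness makes sense. The map
  \<open>\<rho>\<close> of a Leonard pair \<open>A, A\<^sup>*\<close> is the instance \<open>B = A\<^sup>*, P = E\<^sub>0, Q = E\<^sub>0\<^sup>*\<close>; the map \<open>\<rho>\<^sup>*\<close> is the
  instance with all starred and unstarred objects swapped.\<close>

definition rho_map ::
  "('f::field \<Rightarrow> 'v::ab_group_add \<Rightarrow> 'v) \<Rightarrow> ('v \<Rightarrow> 'v) \<Rightarrow> ('v \<Rightarrow> 'v) \<Rightarrow> ('v \<Rightarrow> 'v) \<Rightarrow> ('v \<Rightarrow> 'v)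
    \<Rightarrow> ('v \<Rightarrow> 'v) \<Rightarrow> ('v \<Rightarrow> 'v)" where
  "rho_map scale A B P Q =
     (THE r. r \<in> gen_subalgebra scale A \<rightarrow>\<^sub>E gen_subalgebra scale B \<and>
        (\<forall>Y\<in>gen_subalgebra scale A. \<forall>Z\<in>gen_subalgebra scale A.
           r (\<lambda>v. Y v + Z v) = (\<lambda>v. r Y v + r Z v)) \<and>
        (\<forall>c. \<forall>Y\<in>gen_subalgebra scale A. r (\<lambda>v. scale c (Y v)) = (\<lambda>v. scale c (r Y v))) \<and>
        (\<forall>Y\<in>gen_subalgebra scale A. Y \<circ> Q \<circ> P = r Y \<circ> P))"

end

theory Submission
  imports Defs
begin

text \<open>
  Put \<open>T = W W\<^sup>* W = W\<^sup>* W W\<^sup>*\<close> and let \<open>x\<^sub>0\<close>, \<open>x\<^sub>0\<^sup>*\<close> span the images of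
  \<open>E\<^sub>0\<close>, \<open>E\<^sub>0\<^sup>*\<close>. Since the \<open>x\<^sub>i\<close> make \<open>A\<^sup>*\<close> irreducible tridiagonal, \<open>x\<^sub>0\<close> is a
  cyclic vector for \<open>A\<^sup>*\<close>; carried over by \<open>T\<close>, this says that \<open>x\<^sub>0\<^sup>*\<close> is cyclic for \<open>A\<close>. Two
  operators that commute with \<open>A\<close> are therefore equal as soon as they agree on \<open>x\<^sub>0\<^sup>*\<close>
  (\<open>eq_if_eq_on_cyclic_vector\<close>). On this vector the definition of \<open>\<rho>\<^sup>*\<close> gives
  \<open>A\<^sub>i x\<^sub>0\<^sup>* = \<nu> E\<^sub>i\<^sup>* E\<^sub>0 x\<^sub>0\<^sup>*\<close>, so the two weighted sums of the \<open>A\<^sub>i\<close> become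
  multiples of \<open>(W\<^sup>*)\<^sup>-\<^sup>1 E\<^sub>0 x\<^sub>0\<^sup>*\<close> and \<open>W\<^sup>* E\<^sub>0 x\<^sub>0\<^sup>*\<close>. Because
  \<open>W\<^sup>* x\<^sub>0\<^sup>* = f x\<^sub>0\<^sup>*\<close> and \<open>W E\<^sub>0 = f E\<^sub>0\<close>, what is left to show is
  \<open>T x\<^sub>0\<^sup>* = \<nu> f\<^sup>3 \<gamma> E\<^sub>0 x\<^sub>0\<^sup>*\<close> and \<open>T E\<^sub>0 x\<^sub>0\<^sup>* = f\<^sup>3 \<gamma> x\<^sub>0\<^sup>*\<close>.

  Both follow from \<open>T E\<^sub>0\<^sup>* = E\<^sub>0 T\<close> and \<open>T E\<^sub>0 = E\<^sub>0\<^sup>* T\<close>: by the former, \<open>T x\<^sub>0\<^sup>*\<close> is a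
  multiple of \<open>E\<^sub>0 x\<^sub>0\<^sup>*\<close>, and projecting it back to \<open>x\<^sub>0\<^sup>*\<close> identifies the factor as a trace
  (\<open>T_xs0\<close>); the latter then gives the second formula. Injectivity of \<open>T\<close> shows \<open>\<gamma> \<noteq> 0\<close>.

  The relation \<open>T E\<^sub>0\<^sup>* = E\<^sub>0 T\<close> is the definition of \<open>E\<^sub>0\<^sup>*\<close>. The relation
  \<open>T E\<^sub>0 = E\<^sub>0\<^sup>* T\<close> requires \<open>T\<^sup>2\<close> to commute with \<open>A\<close>, that is, not only
  \<open>T A\<^sup>* = A T\<close>, which is the Boltzmann relation, but also \<open>T A = A\<^sup>* T\<close>. The second one is the
  transpose of the first with respect to a bilinear form for which \<open>A\<close> and \<open>A\<^sup>*\<close> are both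
  self-adjoint (\<open>exists_invariant_form\<close>, \<open>boltzmann_transpose\<close>).

  The formulas for \<open>W\<^sup>*\<close> are those for \<open>W\<close> with starred and unstarred objects exchanged. The
  scalars \<open>\<nu>\<close> and \<open>\<gamma>\<close> are unchanged by this exchange.
\<close>

section \<open>The subalgebra generated by an operator, and cyclic vectors\<close>

locale operator_algebra = vector_space scale
  for scale :: "'f::field \<Rightarrow> 'v::ab_group_add \<Rightarrow> 'v" (infixr "*s" 75)
begin

abbreviation lin :: "('v \<Rightarrow> 'v) \<Rightarrow> bool" where
  "lin \<equiv> Vector_Spaces.linear scale scale"

abbreviation alg :: "('v \<Rightarrow> 'v) \<Rightarrow> ('v \<Rightarrow> 'v) set" where
  "alg \<equiv> gen_subalgebra scale"

lemma lin_iff: "lin X \<longleftrightarrow> (\<forall>u v. X (u + v) = X u + X v) \<and> (\<forall>c v. X (c *s v) = c *s X v)"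
  by (simp add: Vector_Spaces.linear_iff vector_space_axioms)

lemma lin_add: "lin X \<Longrightarrow> X (u + v) = X u + X v"
  by (simp add: lin_iff)

lemma lin_scale: "lin X \<Longrightarrow> X (c *s v) = c *s X v"
  by (simp add: lin_iff)

lemma lin_0: "lin X \<Longrightarrow> X 0 = 0"
  using lin_scale[of X 0 0] by simp

lemma lin_sum: "lin X \<Longrightarrow> X (\<Sum>i\<in>I. g i) = (\<Sum>i\<in>I. X (g i))"
  by (induction I rule: infinite_finite_induct) (simp_all add: lin_0 lin_add)

lemma lin_comp: "lin X \<Longrightarrow> lin Y \<Longrightarrow> lin (X \<circ> Y)"
  by (simp add: lin_iff)

lemma lin_inv:
  assumes "lin X" and "bij X" shows "lin (inv X)"
  unfolding lin_iff
  by (metis assms bij_inv_eq_iff lin_add lin_scale)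

lemma lin_alg:
  assumes "lin A" and "X \<in> alg A" shows "lin X"
  using assms(2) assms(1)
  by (induction rule: gen_subalgebra.induct)
    (simp_all add: lin_iff algebra_simps scale_right_distrib scale_left_commute)

lemma alg_commute:
  assumes "lin X" and "X \<circ> A = A \<circ> X" and "Z \<in> alg A"
  shows "X \<circ> Z = Z \<circ> X"
  using assms(3)
  by (induction rule: gen_subalgebra.induct)
    (simp_all add: assms(2) fun_eq_iff lin_add[OF assms(1)] lin_scale[OF assms(1)]
      comp_apply[of X A, symmetric])

lemma alg_commutes_gen:
  assumes "lin A" and "Z \<in> alg A"
  shows "Z \<circ> A = A \<circ> Z"
  using alg_commute[OF assms(1) refl assms(2)] by simp

lemma alg_commutes:
  assumes "lin A" and "Y \<in> alg A" and "Z \<in> alg A"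
  shows "Y \<circ> Z = Z \<circ> Y"
  using alg_commute[OF lin_alg[OF assms(1,2)] alg_commutes_gen[OF assms(1,2)] assms(3)] .

definition cyclic_vector :: "('v \<Rightarrow> 'v) \<Rightarrow> 'v \<Rightarrow> bool" where
  "cyclic_vector A x \<longleftrightarrow> (\<forall>v. \<exists>Z\<in>alg A. Z x = v)"

text \<open>Every vector is \<open>Z x\<close> with \<open>Z\<close> in the subalgebra, and \<open>X\<close> and \<open>Y\<close> pass through \<open>Z\<close>. So
  identities between operators that commute with \<open>A\<close> reduce to one vector.\<close>

lemma eq_if_eq_on_cyclic_vector:
  assumes "cyclic_vector A x"
    and "lin X" and "X \<circ> A = A \<circ> X"
    and "lin Y" and "Y \<circ> A = A \<circ> Y"
    and "X x = Y x"
  shows "X = Y"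
proof
  fix v
  obtain Z where Z: "Z \<in> alg A" "Z x = v"
    using assms(1) unfolding cyclic_vector_def by blast
  show "X v = Y v"
    using alg_commute[OF assms(2,3) Z(1)] alg_commute[OF assms(4,5) Z(1)] Z(2) assms(6)
    by (metis comp_apply)
qed

lemma in_alg_if_commutes:
  assumes "cyclic_vector A x" and "lin A" and "lin X" and "X \<circ> A = A \<circ> X"
  shows "X \<in> alg A"
proof -
  obtain Z where Z: "Z \<in> alg A" "Z x = X x"
    using assms(1) unfolding cyclic_vector_def by blast
  have "X = Z"
    by (rule eq_if_eq_on_cyclic_vector[OF assms(1,3,4)])
      (simp_all add: Z lin_alg[OF assms(2) Z(1)] alg_commutes_gen[OF assms(2) Z(1)])
  then show ?thesis using Z(1) by simp
qed

text \<open>When the image of \<open>P\<close> is spanned by a cyclic vector \<open>p\<close> of \<open>B\<close>, the condition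
  \<open>Y Q P = r(Y) P\<close> says \<open>r(Y) p = Y (Q p)\<close>, which has exactly one solution \<open>r(Y)\<close> in the algebra
  of \<open>B\<close>. Linearity of \<open>r\<close> follows from this uniqueness, so the definite description in
  \<open>rho_map\<close> is proper.\<close>

lemma rho_map_cyclic:
  assumes A: "lin A" and B: "lin B" and Q: "lin Q" and cyc: "cyclic_vector B p"
    and Pp: "P p = p" and P: "\<And>v. \<exists>c. P v = c *s p"
    and Y: "Y \<in> alg A"
  shows "rho_map scale A B P Q Y \<in> alg B" and "rho_map scale A B P Q Y p = Y (Q p)"
proof -
  define good where "good r \<longleftrightarrow> r \<in> alg A \<rightarrow>\<^sub>E alg B \<and>
        (\<forall>Y\<in>alg A. \<forall>Z\<in>alg A. r (\<lambda>v. Y v + Z v) = (\<lambda>v. r Y v + r Z v)) \<and>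
        (\<forall>c. \<forall>Y\<in>alg A. r (\<lambda>v. c *s Y v) = (\<lambda>v. c *s r Y v)) \<and>
        (\<forall>Y\<in>alg A. Y \<circ> Q \<circ> P = r Y \<circ> P)" for r
  have uniq: "X = Z" if "X \<in> alg B" "Z \<in> alg B" "X p = Z p" for X Z
    by (rule eq_if_eq_on_cyclic_vector[OF cyc lin_alg[OF B that(1)] alg_commutes_gen[OF B that(1)]
          lin_alg[OF B that(2)] alg_commutes_gen[OF B that(2)] that(3)])
  have iff: "Y \<circ> Q \<circ> P = Z \<circ> P \<longleftrightarrow> Z p = Y (Q p)" if "Y \<in> alg A" "Z \<in> alg B" for Y Z
  proof
    assume "Y \<circ> Q \<circ> P = Z \<circ> P"
    then show "Z p = Y (Q p)" using Pp by (metis comp_apply)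
  next
    assume eq: "Z p = Y (Q p)"
    show "Y \<circ> Q \<circ> P = Z \<circ> P"
    proof
      fix v
      obtain c where "P v = c *s p" using P by blast
      then show "(Y \<circ> Q \<circ> P) v = (Z \<circ> P) v"
        using eq by (simp add: lin_scale Q lin_alg[OF A that(1)] lin_alg[OF B that(2)])
    qed
  qed
  have "\<forall>Y. \<exists>Z\<in>alg B. Z p = Y (Q p)"
    using cyc unfolding cyclic_vector_def by blast
  then obtain g where g: "\<And>Y. g Y \<in> alg B" "\<And>Y. g Y p = Y (Q p)" by metis
  have "good (restrict g (alg A))"
    unfolding good_def
  proof (intro conjI ballI allI)
    show "restrict g (alg A) \<in> alg A \<rightarrow>\<^sub>E alg B" using g(1) by auto
  next
    fix Y Z assume YZ: "Y \<in> alg A" "Z \<in> alg A"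
    have "g (\<lambda>v. Y v + Z v) = (\<lambda>v. g Y v + g Z v)"
      by (rule uniq) (simp_all add: g gen_subalgebra.add)
    then show "restrict g (alg A) (\<lambda>v. Y v + Z v)
        = (\<lambda>v. restrict g (alg A) Y v + restrict g (alg A) Z v)"
      using YZ by (simp add: gen_subalgebra.add)
  next
    fix c Y assume Y: "Y \<in> alg A"
    have "g (\<lambda>v. c *s Y v) = (\<lambda>v. c *s g Y v)"
      by (rule uniq) (simp_all add: g gen_subalgebra.scale)
    then show "restrict g (alg A) (\<lambda>v. c *s Y v) = (\<lambda>v. c *s restrict g (alg A) Y v)"
      using Y by (simp add: gen_subalgebra.scale)
  next
    fix Y assume Y: "Y \<in> alg A"
    then show "Y \<circ> Q \<circ> P = restrict g (alg A) Y \<circ> P"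
      using iff[OF Y g(1)] g(2) by simp
  qed
  moreover have "r = restrict g (alg A)" if r: "good r" for r
  proof
    fix Y
    show "r Y = restrict g (alg A) Y"
    proof (cases "Y \<in> alg A")
      case True
      then have mem: "r Y \<in> alg B" and eq: "Y \<circ> Q \<circ> P = r Y \<circ> P"
        using r by (auto simp: good_def)
      have "r Y p = g Y p" using iff[OF True mem] eq g(2) by simp
      then show ?thesis using uniq[OF mem g(1)] True by simp
    next
      case False
      then show ?thesis using r by (auto simp: good_def PiE_def extensional_def)
    qed
  qed
  ultimately have "rho_map scale A B P Q = restrict g (alg A)"
    unfolding rho_map_def good_def by (rule the_equality)
  then show "rho_map scale A B P Q Y \<in> alg B" and "rho_map scale A B P Q Y p = Y (Q p)"
    using Y g by simp_all
qed

end

section \<open>Rank-one resolutions of the identity\<close>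

context operator_algebra
begin

text \<open>Here \<open>E\<^sub>i\<close> reads off the term of a linear combination that belongs to \<open>x\<^sub>i\<close>, which
  forces the \<open>x\<^sub>i\<close> to be independent.\<close>

lemma dual_family_apply:
  fixes d :: nat and x :: "nat \<Rightarrow> 'v"
  assumes E: "\<And>i. i \<le> d \<Longrightarrow> lin (E i)"
    and E_x: "\<And>i j. i \<le> d \<Longrightarrow> j \<le> d \<Longrightarrow> E i (x j) = (if i = j then x j else 0)"
    and i: "i \<le> d"
  shows "E i (\<Sum>j\<le>d. u j *s x j) = u i *s x i"
proof -
  have "E i (\<Sum>j\<le>d. u j *s x j) = (\<Sum>j\<le>d. if j = i then u i *s x i else 0)"
    unfolding lin_sum[OF E[OF i]]
    by (rule sum.cong) (use i in \<open>auto simp: lin_scale[OF E] E_x\<close>)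
  then show ?thesis using i by simp
qed

lemma dual_family_inj:
  fixes d :: nat and x :: "nat \<Rightarrow> 'v"
  assumes E: "\<And>i. i \<le> d \<Longrightarrow> lin (E i)"
    and E_x: "\<And>i j. i \<le> d \<Longrightarrow> j \<le> d \<Longrightarrow> E i (x j) = (if i = j then x j else 0)"
    and x: "\<And>i. i \<le> d \<Longrightarrow> x i \<noteq> 0"
  shows "inj_on x {..d}"
proof (rule inj_onI)
  fix i j assume ij: "i \<in> {..d}" "j \<in> {..d}" "x i = x j"
  then have "E i (x i) = E i (x j)" by simp
  then show "i = j" using ij E_x[of i i] E_x[of i j] x[of i] by (auto split: if_splits)
qed

lemma dual_family_independent:
  fixes d :: nat and x :: "nat \<Rightarrow> 'v"
  assumes E: "\<And>i. i \<le> d \<Longrightarrow> lin (E i)"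
    and E_x: "\<And>i j. i \<le> d \<Longrightarrow> j \<le> d \<Longrightarrow> E i (x j) = (if i = j then x j else 0)"
    and x: "\<And>i. i \<le> d \<Longrightarrow> x i \<noteq> 0"
  shows "independent (x ` {..d})"
proof -
  have inj: "inj_on x {..d}" by (rule dual_family_inj[OF E E_x x])
  have "u (x i) = 0" if sum: "(\<Sum>v\<in>x ` {..d}. u v *s v) = 0" and i: "i \<le> d" for u i
  proof -
    have "E i (\<Sum>j\<le>d. u (x j) *s x j) = 0"
      using sum lin_0[OF E[OF i]] by (simp add: sum.reindex[OF inj])
    then have "u (x i) *s x i = 0"
      using dual_family_apply[of d E x i "\<lambda>j. u (x j)", OF E E_x i] by simp
    then show ?thesis using x[OF i] by simp
  qed
  then show ?thesis by (auto simp: dependent_finite)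
qed

end

text \<open>The families \<open>E\<^sub>i\<close> and \<open>E\<^sub>i\<^sup>*\<close> both have the following shape, with \<open>x\<^sub>i\<close> an
  eigenvector of \<open>A\<close> or \<open>A\<^sup>*\<close>.\<close>

locale rank_one_resolution = operator_algebra scale
  for scale :: "'f::field \<Rightarrow> 'v::ab_group_add \<Rightarrow> 'v" (infixr "*s" 75) +
  fixes d :: nat and E :: "nat \<Rightarrow> 'v \<Rightarrow> 'v" and x :: "nat \<Rightarrow> 'v"
  assumes E_lin: "i \<le> d \<Longrightarrow> lin (E i)"
    and E_x: "i \<le> d \<Longrightarrow> j \<le> d \<Longrightarrow> E i (x j) = (if i = j then x j else 0)"
    and x_nonzero: "i \<le> d \<Longrightarrow> x i \<noteq> 0"
    and E_range: "i \<le> d \<Longrightarrow> \<exists>c. E i v = c *s x i"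
    and E_sum: "(\<Sum>i\<le>d. E i v) = v"
begin

lemma E_E:
  assumes "i \<le> d" and "j \<le> d"
  shows "E i (E j v) = (if i = j then E j v else 0)"
proof -
  obtain c where "E j v = c *s x j" using E_range[OF assms(2)] by blast
  then show ?thesis using E_lin[OF assms(1)] E_x[OF assms] by (simp add: lin_scale)
qed

lemmas inj_x = dual_family_inj[of d E x, OF E_lin E_x x_nonzero]
  and independent_x = dual_family_independent[of d E x, OF E_lin E_x x_nonzero]
  and E_combination = dual_family_apply[of d E x, OF E_lin E_x]

lemma span_x: "span (x ` {..d}) = UNIV"
proof -
  have "v \<in> span (x ` {..d})" for v
  proof -
    have "(\<Sum>i\<le>d. E i v) \<in> span (x ` {..d})"
    proof (rule span_sum)
      fix i assume "i \<in> {..d}"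
      then show "E i v \<in> span (x ` {..d})"
        using E_range[of i v] span_scale[OF span_base, of "x i" "x ` {..d}"] by auto
    qed
    then show ?thesis by (simp add: E_sum)
  qed
  then show ?thesis by blast
qed

definition coord :: "nat \<Rightarrow> 'v \<Rightarrow> 'f" where
  "coord i v = representation (x ` {..d}) v (x i)"

lemma coord_add: "coord i (u + v) = coord i u + coord i v"
  by (simp add: coord_def representation_add independent_x span_x)

lemma coord_scale: "coord i (c *s v) = c * coord i v"
  by (simp add: coord_def representation_scale independent_x span_x)

lemma coord_sum: "coord i (\<Sum>j\<in>J. g j) = (\<Sum>j\<in>J. coord i (g j))"
  by (simp add: coord_def representation_sum independent_x span_x)

lemma coord_x: "i \<le> d \<Longrightarrow> j \<le> d \<Longrightarrow> coord i (x j) = (if i = j then 1 else 0)"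
  by (auto simp: coord_def representation_basis independent_x inj_on_eq_iff[OF inj_x])

lemma sum_coord: "(\<Sum>i\<le>d. coord i v *s x i) = v"
  using sum_representation_eq[OF independent_x, of v "x ` {..d}"] span_x
  by (simp add: sum.reindex[OF inj_x] coord_def)

lemma coord_apply:
  assumes "lin X"
  shows "coord i (X v) = (\<Sum>j\<le>d. matrix_wrt scale d x X i j * coord j v)"
proof -
  have "X v = (\<Sum>j\<le>d. coord j v *s X (x j))"
    using lin_sum[OF assms, of "\<lambda>j. coord j v *s x j" "{..d}"]
    by (simp add: sum_coord lin_scale[OF assms])
  then have "coord i (X v) = (\<Sum>j\<le>d. coord j v * coord i (X (x j)))"
    by (simp add: coord_sum coord_scale)
  then show ?thesis
    by (simp add: matrix_wrt_def coord_def mult.commute)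
qed

lemma trace_rank_one:
  assumes "lin X" and "E 0 (X (x 0)) = g *s x 0"
  shows "lin_trace scale (X \<circ> E 0) = g"
proof -
  have E0: "lin (E 0)" by (simp add: E_lin)
  have "lin_trace scale (X \<circ> E 0) = (\<Sum>b\<in>x ` {..d}. representation (x ` {..d}) ((X \<circ> E 0) b) b)"
    by (rule lin_trace_eq)
      (simp_all add: vector_space_axioms independent_x span_x lin_comp assms(1) E0)
  also have "\<dots> = (\<Sum>i\<le>d. coord i (X (E 0 (x i))))"
    by (simp add: sum.reindex[OF inj_x] coord_def)
  also have "\<dots> = (\<Sum>i\<le>d. if i = 0 then coord 0 (X (x 0)) else 0)"
  proof (rule sum.cong[OF refl])
    fix i assume "i \<in> {..d}"
    then show "coord i (X (E 0 (x i))) = (if i = 0 then coord 0 (X (x 0)) else 0)"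
      using E_x[of 0 i] lin_0[OF assms(1)] coord_scale[of i 0 0] by simp
  qed
  also have "\<dots> = coord 0 (X (x 0))" by simp
  also have "\<dots> = g"
  proof -
    let ?v = "X (x 0)"
    have "E 0 ?v = coord 0 ?v *s x 0"
      using E_combination[of 0 "\<lambda>i. coord i ?v"] by (simp add: sum_coord)
    then show ?thesis using assms(2) x_nonzero[of 0] by simp
  qed
  finally show ?thesis .
qed

text \<open>The subdiagonal entries are nonzero, so \<open>B x\<^sub>i\<close> is a nonzero multiple of
  \<open>x\<^sub>i\<^sub>+\<^sub>1\<close> modulo the earlier \<open>x\<^sub>j\<close>, and applying \<open>B\<close> repeatedly to \<open>x\<^sub>0\<close> reaches them all.\<close>

lemma cyclic_if_irreducible_tridiagonal:
  assumes B: "lin B" and tri: "irreducible_tridiagonal d (matrix_wrt scale d x B)"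
  shows "cyclic_vector B (x 0)"
proof -
  define S where "S = {v. \<exists>Z\<in>alg B. Z (x 0) = v}"
  have add: "u + v \<in> S" if "u \<in> S" "v \<in> S" for u v
    using that gen_subalgebra.add unfolding S_def by fastforce
  have scl: "c *s u \<in> S" if "u \<in> S" for c u
    using that gen_subalgebra.scale unfolding S_def by fastforce
  have x0: "x 0 \<in> S"
    unfolding S_def using gen_subalgebra.one[of scale B] by (auto intro!: bexI[of _ id])
  have zero: "0 \<in> S" using scl[OF x0, of 0] by simp
  have sub: "subspace S"
    by (rule subspaceI) (use add scl zero in auto)
  have inv: "B u \<in> S" if u: "u \<in> S" for u
  proof -
    obtain Z where Z: "Z \<in> alg B" "Z (x 0) = u" using u unfolding S_def by blast
    have "B \<circ> Z \<in> alg B" using gen_subalgebra.mult[OF gen_subalgebra.gen Z(1)] .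
    then show ?thesis unfolding S_def using Z(2) by (auto intro!: bexI[of _ "B \<circ> Z"])
  qed
  have mem: "x i \<in> S" if "i \<le> d" for i
    using that
  proof (induction i rule: less_induct)
    case (less i)
    show ?case
    proof (cases i)
      case 0
      then show ?thesis using x0 by simp
    next
      case (Suc j)
      let ?b = "\<lambda>k. coord k (B (x j))"
      have b: "?b k = matrix_wrt scale d x B k j" for k
        by (simp add: coord_def matrix_wrt_def)
      have nz: "?b i \<noteq> 0"
        using tri less.prems Suc unfolding b irreducible_tridiagonal_def by simp
      have "B (x j) = ?b i *s x i + (\<Sum>k\<in>{..d} - {i}. ?b k *s x k)"
        using sum_coord[of "B (x j)"] less.prems by (simp add: sum.remove[of "{..d}" i])
      then have eq: "?b i *s x i = B (x j) - (\<Sum>k\<in>{..d} - {i}. ?b k *s x k)"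
        by (metis eq_diff_eq)
      have "(\<Sum>k\<in>{..d} - {i}. ?b k *s x k) \<in> S"
      proof (rule subspace_sum[OF sub])
        fix k assume k: "k \<in> {..d} - {i}"
        show "?b k *s x k \<in> S"
        proof (cases "k < i")
          case True
          then show ?thesis using less.IH k scl by simp
        next
          case False
          then have "?b k = 0"
            using k Suc less.prems tri unfolding b irreducible_tridiagonal_def by auto
          then show ?thesis using zero by simp
        qed
      qed
      moreover have "B (x j) \<in> S" using inv less.IH less.prems Suc by simp
      ultimately have "?b i *s x i \<in> S"
        unfolding eq by (rule subspace_diff[OF sub, rotated])
      then have "inverse (?b i) *s (?b i *s x i) \<in> S" by (rule scl)
      then show ?thesis using nz by simp
    qed
  qed
  then have "x ` {..d} \<subseteq> S" by auto
  then have "span (x ` {..d}) \<subseteq> S" by (rule span_minimal[OF _ sub])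
  then show ?thesis unfolding span_x cyclic_vector_def S_def by blast
qed

text \<open>Rescaling the basis by \<open>k\<^sub>i\<close> symmetrizes an irreducible tridiagonal matrix; the product
  below accumulates the ratios of opposite off-diagonal entries. A diagonal matrix stays
  symmetric, so one form makes both operators self-adjoint. It gives the antiautomorphism of
  \<open>End(V)\<close> that fixes \<open>A\<close> and \<open>A\<^sup>*\<close>.\<close>

lemma exists_invariant_form:
  assumes B: "lin B" and tri: "irreducible_tridiagonal d (matrix_wrt scale d x B)"
    and A: "lin A" and eig: "\<And>i. i \<le> d \<Longrightarrow> A (x i) = \<theta> i *s x i"
  obtains F :: "'v \<Rightarrow> 'v \<Rightarrow> 'f"
  where "\<And>u v w. F (u + v) w = F u w + F v w" "\<And>u v w. F w (u + v) = F w u + F w v"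
    and "\<And>c u v. F (c *s u) v = c * F u v" "\<And>c u v. F u (c *s v) = c * F u v"
    and "\<And>u v. (\<And>w. F w u = F w v) \<Longrightarrow> u = v"
    and "\<And>u v. F (A u) v = F u (A v)" "\<And>u v. F (B u) v = F u (B v)"
proof -
  define b where "b = matrix_wrt scale d x B"
  define k where "k i = (\<Prod>l<i. b l (Suc l) / b (Suc l) l)" for i
  have off: "b i (Suc i) \<noteq> 0" "b (Suc i) i \<noteq> 0" if "i < d" for i
    using tri that unfolding b_def irreducible_tridiagonal_def by auto
  have k_nz: "k i \<noteq> 0" if "i \<le> d" for i
    using that off unfolding k_def by (simp add: prod_zero_iff)
  have k_step: "k i * b i (Suc i) = k (Suc i) * b (Suc i) i" if "i < d" for i
    using off[OF that] by (simp add: k_def)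
  have sym_b: "k i * b i j = k j * b j i" if "i \<le> d" "j \<le> d" for i j
  proof -
    consider "i = j" | "j = Suc i" | "i = Suc j" | "i + 1 < j" | "j + 1 < i" by linarith
    then show ?thesis
    proof cases
      case 2 then show ?thesis using k_step[of i] that by simp
    next
      case 3 then show ?thesis using k_step[of j] that by simp
    qed (use tri that in \<open>simp_all add: b_def irreducible_tridiagonal_def\<close>)
  qed
  define F where "F u v = (\<Sum>i\<le>d. k i * coord i u * coord i v)" for u v
  have adjoint: "F (X u) v = F u (X v)"
    if X: "lin X" and sym: "\<And>i j. i \<le> d \<Longrightarrow> j \<le> d \<Longrightarrow>
      k i * matrix_wrt scale d x X i j = k j * matrix_wrt scale d x X j i" for X u v
  proof -
    let ?M = "matrix_wrt scale d x X"
    have "F (X u) v = (\<Sum>i\<le>d. \<Sum>j\<le>d. (k i * ?M i j) * coord j u * coord i v)"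
      unfolding F_def coord_apply[OF X]
      by (simp add: sum_distrib_left sum_distrib_right mult_ac)
    also have "\<dots> = (\<Sum>i\<le>d. \<Sum>j\<le>d. (k j * ?M j i) * coord j u * coord i v)"
      by (intro sum.cong refl) (use sym in auto)
    also have "\<dots> = (\<Sum>j\<le>d. \<Sum>i\<le>d. (k j * ?M j i) * coord j u * coord i v)"
      by (rule sum.swap)
    also have "\<dots> = F u (X v)"
      unfolding F_def coord_apply[OF X]
      by (simp add: sum_distrib_left sum_distrib_right mult_ac)
    finally show ?thesis .
  qed
  show thesis
  proof (rule that[of F])
    show "F (u + v) w = F u w + F v w" "F w (u + v) = F w u + F w v" for u v w
      by (simp_all add: F_def coord_add algebra_simps sum.distrib)
    show "F (c *s u) v = c * F u v" "F u (c *s v) = c * F u v" for c u v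
      by (simp_all add: F_def coord_scale sum_distrib_left mult_ac)
    show "F (B u) v = F u (B v)" for u v
      by (rule adjoint[OF B]) (use sym_b in \<open>simp add: b_def\<close>)
    show "F (A u) v = F u (A v)" for u v
    proof (rule adjoint[OF A])
      have "matrix_wrt scale d x A i j = (if i = j then \<theta> j else 0)" if "i \<le> d" "j \<le> d" for i j
        using coord_scale[of i "\<theta> j" "x j"] coord_x[OF that] eig[OF that(2)]
        by (simp add: matrix_wrt_def coord_def)
      then show "k i * matrix_wrt scale d x A i j = k j * matrix_wrt scale d x A j i"
        if "i \<le> d" "j \<le> d" for i j using that by simp
    qed
    show "u = v" if eq: "\<And>w. F w u = F w v" for u v
    proof -
      have "coord i u = coord i v" if i: "i \<le> d" for i
      proof -
        have "F (x i) w = k i * coord i w" for w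
        proof -
          have "F (x i) w = (\<Sum>j\<le>d. if j = i then k i * coord i w else 0)"
            unfolding F_def by (rule sum.cong) (use i in \<open>auto simp: coord_x\<close>)
          then show ?thesis using i by simp
        qed
        then show ?thesis using eq[of "x i"] k_nz[OF i] by simp
      qed
      then have "(\<Sum>i\<le>d. coord i u *s x i) = (\<Sum>i\<le>d. coord i v *s x i)" by simp
      then show ?thesis unfolding sum_coord .
    qed
  qed
qed

end

section \<open>Eigenbases from a standard ordering\<close>

context operator_algebra
begin

text \<open>There are \<open>d + 1\<close> different idempotents \<open>E\<^sub>i\<close>, and a primitive idempotent of the
  diagonalizable \<open>A\<close> is determined by its eigenvalue. So the eigenvalues are distinct, and
  eigenvectors chosen in the images of the \<open>E\<^sub>i\<close> form a basis.\<close>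

lemma standard_ordering_eigenbasis:
  assumes leonard: "leonard_pair scale d A As" and std: "standard_ordering scale d A As E"
  obtains x \<theta> where "rank_one_resolution scale d E x"
    and "\<And>i. i \<le> d \<Longrightarrow> A (x i) = \<theta> i *s x i"
    and "irreducible_tridiagonal d (matrix_wrt scale d x As)"
    and "\<And>i j v. i \<le> d \<Longrightarrow> j \<le> d \<Longrightarrow> A v = \<theta> j *s v \<Longrightarrow> E i v = (if i = j then v else 0)"
proof -
  have bij: "bij_betw E {..d} {P. primitive_idempotent scale A P}"
    using std by (simp add: standard_ordering_def)
  then have prim: "primitive_idempotent scale A (E i)" if "i \<le> d" for i
    using that unfolding bij_betw_def by auto
  then have E_lin: "lin (E i)" if "i \<le> d" for i
    using that by (simp add: primitive_idempotent_def)
  have "\<exists>t y. i \<le> d \<longrightarrow> y \<noteq> 0 \<and> A y = t *s y \<and> (\<forall>v. A v = t *s v \<longrightarrow> E i v = v)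
      \<and> (\<forall>\<mu> v. \<mu> \<noteq> t \<longrightarrow> A v = \<mu> *s v \<longrightarrow> E i v = 0)" for i
  proof (cases "i \<le> d")
    case True
    obtain t where t: "eigenspace scale A t \<noteq> {0}" "\<forall>v\<in>eigenspace scale A t. E i v = v"
      "\<forall>\<mu>. \<mu> \<noteq> t \<longrightarrow> (\<forall>v\<in>eigenspace scale A \<mu>. E i v = 0)"
      using prim[OF True] unfolding primitive_idempotent_def by blast
    have "0 \<in> eigenspace scale A t"
      using leonard lin_0 by (simp add: eigenspace_def leonard_pair_def)
    then obtain y where "y \<in> eigenspace scale A t" "y \<noteq> 0" using t(1) by blast
    then show ?thesis using t(2,3) unfolding eigenspace_def by blast
  qed simp
  then obtain \<theta> x where
    all: "\<And>i. i \<le> d \<longrightarrow> x i \<noteq> 0 \<and> A (x i) = \<theta> i *s x i \<and> (\<forall>v. A v = \<theta> i *s v \<longrightarrow> E i v = v)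
      \<and> (\<forall>\<mu> v. \<mu> \<noteq> \<theta> i \<longrightarrow> A v = \<mu> *s v \<longrightarrow> E i v = 0)"
    by metis
  have x: "x i \<noteq> 0" "A (x i) = \<theta> i *s x i" "\<And>v. A v = \<theta> i *s v \<Longrightarrow> E i v = v"
      "\<And>\<mu> v. \<mu> \<noteq> \<theta> i \<Longrightarrow> A v = \<mu> *s v \<Longrightarrow> E i v = 0" if "i \<le> d" for i
    using all that by blast+
  obtain w where w: "basis_seq scale d w" "diagonal_matrix d (matrix_wrt scale d w A)"
    using leonard unfolding leonard_pair_def by blast
  have w_ind: "independent (w ` {..d})" and w_span: "span (w ` {..d}) = UNIV"
    and w_inj: "inj_on w {..d}"
    using w(1) by (auto simp: basis_seq_def)
  have w_eig: "\<exists>t. A (w j) = t *s w j" if j: "j \<le> d" for j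
  proof -
    let ?r = "\<lambda>i. representation (w ` {..d}) (A (w j)) (w i)"
    have "A (w j) = (\<Sum>i\<le>d. ?r i *s w i)"
      using sum_representation_eq[OF w_ind, of "A (w j)" "w ` {..d}"] w_span
      by (simp add: sum.reindex[OF w_inj])
    also have "\<dots> = (\<Sum>i\<le>d. if i = j then ?r j *s w j else 0)"
      by (rule sum.cong) (use w(2) j in \<open>auto simp: diagonal_matrix_def matrix_wrt_def\<close>)
    finally show ?thesis using j by auto
  qed
  have \<theta>_inj: "i = j" if ij: "i \<le> d" "j \<le> d" "\<theta> i = \<theta> j" for i j
  proof -
    have on_basis: "E i v = E j v" if v: "v \<in> w ` {..d}" for v
    proof -
      obtain t where t: "A v = t *s v" using w_eig v by blast
      show ?thesis
      proof (cases "t = \<theta> i")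
        case True
        then show ?thesis using t x(3)[OF ij(1)] x(3)[OF ij(2)] ij(3) by simp
      next
        case False
        then show ?thesis using t x(4)[OF ij(1)] x(4)[OF ij(2)] ij(3) by simp
      qed
    qed
    have sub: "subspace {v. E i v = E j v}"
      using E_lin[OF ij(1)] E_lin[OF ij(2)]
      by (intro subspaceI) (simp_all add: lin_0 lin_add lin_scale)
    have "span (w ` {..d}) \<subseteq> {v. E i v = E j v}"
      by (rule span_minimal[OF _ sub]) (use on_basis in blast)
    then have "E i = E j" using w_span by blast
    then show "i = j" using bij ij(1,2) unfolding bij_betw_def inj_on_def by simp
  qed
  have eig: "E i v = (if i = j then v else 0)" if "i \<le> d" "j \<le> d" "A v = \<theta> j *s v" for i j v
    using x(3)[OF that(1)] x(4)[OF that(1)] \<theta>_inj[OF that(1,2)] that(3) by metis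
  have E_x: "E i (x j) = (if i = j then x j else 0)" if "i \<le> d" "j \<le> d" for i j
    using eig[OF that x(2)[OF that(2)]] .
  note dual = E_lin E_x x(1)
  have x_inj: "inj_on x {..d}" by (rule dual_family_inj[of d E x, OF dual])
  have x_ind: "independent (x ` {..d})" by (rule dual_family_independent[of d E x, OF dual])
  have E_comb: "E i (\<Sum>j\<le>d. u j *s x j) = u i *s x i" if "i \<le> d" for i u
    by (rule dual_family_apply[of d E x, OF E_lin E_x that])
  have combination: "\<exists>u. v = (\<Sum>j\<le>d. u j *s x j)" for v
  proof -
    have "v \<in> span (x ` {..d})"
    proof (rule ccontr)
      assume not: "v \<notin> span (x ` {..d})"
      then have ind: "independent (insert v (x ` {..d}))" using x_ind by (rule independent_insertI)
      have "card (insert v (x ` {..d})) \<le> card (w ` {..d})"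
        using independent_span_bound[OF _ ind, of "w ` {..d}"] w_span by simp
      moreover have "v \<notin> x ` {..d}" using not span_base[of v "x ` {..d}"] by blast
      ultimately show False by (simp add: card_image x_inj w_inj)
    qed
    then have "(\<Sum>j\<le>d. representation (x ` {..d}) v (x j) *s x j) = v"
      using sum_representation_eq[OF x_ind, of v "x ` {..d}"]
      by (simp add: sum.reindex[OF x_inj])
    then show ?thesis by (intro exI) (rule sym)
  qed
  have "rank_one_resolution scale d E x"
  proof (intro rank_one_resolution.intro rank_one_resolution_axioms.intro, goal_cases)
    case 1 show ?case by (rule operator_algebra_axioms)
  next
    case (2 i) then show ?case by (rule E_lin)
  next
    case (3 i j) then show ?case by (rule E_x)
  next
    case (4 i) then show ?case by (rule x(1))
  next
    case (5 i v)
    obtain u where "v = (\<Sum>j\<le>d. u j *s x j)" using combination[of v] by blast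
    then have "E i v = u i *s x i" using E_comb[OF 5] by simp
    then show ?case by blast
  next
    case (6 v)
    obtain u where "v = (\<Sum>j\<le>d. u j *s x j)" using combination[of v] by blast
    then show ?case using E_comb by simp
  qed
  moreover have "irreducible_tridiagonal d (matrix_wrt scale d x As)"
  proof -
    have "x i \<in> range (E i)" if "i \<le> d" for i
      using E_x[OF that that] by (metis rangeI)
    then show ?thesis using std x(1) unfolding standard_ordering_def by blast
  qed
  ultimately show thesis using x(2) eig that by blast
qed

end

section \<open>The spin relations\<close>

text \<open>The assumptions are invariant under exchanging starred and unstarred objects, so every
  consequence may be used twice. For that reason \<open>x\<^sub>i\<close> and \<open>x\<^sub>i\<^sup>*\<close> are not tied
  to each other by \<open>T\<close>: \<open>T\<close> maps each of the lines spanned by \<open>x\<^sub>0\<close> and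
  \<open>x\<^sub>0\<^sup>*\<close> to the other one, but with scalars that differ in general.\<close>

locale spin_configuration =
  E: rank_one_resolution scale d E x + Es: rank_one_resolution scale d Es xs
  for scale :: "'f::field \<Rightarrow> 'v::ab_group_add \<Rightarrow> 'v" (infixr "*s" 75)
    and d :: nat and E x Es xs +
  fixes A As W Ws T :: "'v \<Rightarrow> 'v" and f :: 'f and \<tau> :: "nat \<Rightarrow> 'f"
  assumes A_lin: "E.lin A" and As_lin: "E.lin As"
    and E_A: "i \<le> d \<Longrightarrow> E i \<circ> A = A \<circ> E i" and Es_As: "i \<le> d \<Longrightarrow> Es i \<circ> As = As \<circ> Es i"
    and cyc: "E.cyclic_vector As (x 0)" and cycs: "E.cyclic_vector A (xs 0)"
    and f_nonzero: "f \<noteq> 0" and \<tau>_nonzero: "i \<le> d \<Longrightarrow> \<tau> i \<noteq> 0" and \<tau>_0: "\<tau> 0 = 1"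
    and W_eq: "W v = f *s (\<Sum>i\<le>d. \<tau> i *s E i v)"
    and Ws_eq: "Ws v = f *s (\<Sum>i\<le>d. \<tau> i *s Es i v)"
    and W_bij: "bij W" and Ws_bij: "bij Ws"
    and T_W: "W (Ws (W v)) = T v" and T_Ws: "Ws (W (Ws v)) = T v"
    and T_E0: "T (E 0 v) = Es 0 (T v)" and T_Es0: "T (Es 0 v) = E 0 (T v)"
begin

lemma swapped: "spin_configuration scale d Es xs E x As A Ws W T f \<tau>"
  by (intro spin_configuration.intro spin_configuration_axioms.intro)
    (fact E.rank_one_resolution_axioms Es.rank_one_resolution_axioms A_lin As_lin E_A Es_As cyc cycs f_nonzero \<tau>_nonzero \<tau>_0 W_eq Ws_eq W_bij Ws_bij
      T_W T_Ws T_E0 T_Es0)+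

lemma W_lin: "E.lin W"
  unfolding E.lin_iff W_eq
  by (simp add: E.lin_add[OF E.E_lin] E.lin_scale[OF E.E_lin] E.scale_right_distrib sum.distrib
      E.scale_sum_right E.scale_left_commute mult_ac)

lemma W_E:
  assumes "i \<le> d" shows "W (E i v) = (f * \<tau> i) *s E i v"
proof -
  have "(\<Sum>j\<le>d. \<tau> j *s E j (E i v)) = (\<Sum>j\<le>d. if j = i then \<tau> i *s E i v else 0)"
    by (rule sum.cong) (use assms E.E_E in auto)
  then show ?thesis using assms by (simp add: W_eq)
qed

lemma E0_W: "E 0 (W v) = f *s E 0 v"
proof -
  have E0: "E.lin (E 0)" by (simp add: E.E_lin)
  have "E 0 (\<Sum>j\<le>d. \<tau> j *s E j v) = (\<Sum>j\<le>d. if j = 0 then E 0 v else 0)"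
    unfolding E.lin_sum[OF E0]
    by (rule sum.cong) (auto simp: E.lin_scale[OF E0] E.E_E \<tau>_0)
  then show ?thesis using E.lin_scale[OF E0] by (simp add: W_eq)
qed

lemma W_A: "W \<circ> A = A \<circ> W"
proof
  fix v
  have "E i (A v) = A (E i v)" if "i \<le> d" for i using fun_cong[OF E_A[OF that]] by simp
  then show "(W \<circ> A) v = (A \<circ> W) v"
    by (simp add: W_eq E.lin_sum[OF A_lin] E.lin_scale[OF A_lin])
qed

lemma E_in_alg: "i \<le> d \<Longrightarrow> E i \<in> E.alg A"
  using E.in_alg_if_commutes[OF cycs A_lin E.E_lin E_A] .

lemma T_lin: "E.lin T"
proof -
  interpret S: spin_configuration scale d Es xs E x As A Ws W T f \<tau> by (rule swapped)
  have "T = W \<circ> (Ws \<circ> W)" by (simp add: fun_eq_iff T_W)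
  then show ?thesis using E.lin_comp W_lin S.W_lin by simp
qed

lemma T_inj: "T u = T v \<Longrightarrow> u = v"
  by (metis T_W W_bij Ws_bij bij_is_inj injD)

lemma T_commutes_W: "T (W v) = Ws (T v)"
  by (metis T_W T_Ws)

text \<open>\<open>E\<^sub>0\<close> commutes with \<open>A\<close>, so if it killed a cyclic vector of \<open>A\<close> it would be zero.\<close>

lemma E0_xs0_nonzero: "E 0 (xs 0) \<noteq> 0"
proof
  assume eq: "E 0 (xs 0) = 0"
  have "E 0 = (\<lambda>v. 0)"
    by (rule E.eq_if_eq_on_cyclic_vector[OF cycs E.E_lin E_A])
      (simp_all add: eq E.lin_iff fun_eq_iff E.lin_0[OF A_lin])
  then show False using E.E_x[of 0 0] E.x_nonzero[of 0] by (simp add: fun_eq_iff)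
qed

text \<open>If \<open>E\<^sub>0\<^sup>* x\<^sub>0 = a x\<^sub>0\<^sup>*\<close> and \<open>E\<^sub>0 x\<^sub>0\<^sup>* = b x\<^sub>0\<close>, both conditions on \<open>\<nu>\<close> say
  \<open>\<nu> a b = 1\<close>; here \<open>a\<close> and \<open>b\<close> are nonzero by cyclicity.\<close>

lemma nu_nonzero_and_E0_Es0:
  defines "\<nu> \<equiv> nu_scalar scale (E 0) (Es 0)"
  shows "\<nu> \<noteq> 0" and "\<nu> *s Es 0 (E 0 (xs 0)) = xs 0"
    and "nu_scalar scale (Es 0) (E 0) = \<nu>"
proof -
  interpret S: spin_configuration scale d Es xs E x As A Ws W T f \<tau> by (rule swapped)
  have lin: "E.lin (E 0)" "E.lin (Es 0)" by (simp_all add: E.E_lin Es.E_lin)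
  obtain a b where a: "Es 0 (x 0) = a *s xs 0" and b: "E 0 (xs 0) = b *s x 0"
    using E.E_range Es.E_range by blast
  have nz: "a \<noteq> 0" "b \<noteq> 0" using E0_xs0_nonzero S.E0_xs0_nonzero a b by auto
  let ?c = "inverse (a * b)"
  have Ex: "E 0 (x 0) = x 0" "Es 0 (xs 0) = xs 0" by (simp_all add: E.E_x Es.E_x)
  have 1: "(\<lambda>v. c *s ((E 0 \<circ> Es 0 \<circ> E 0) v)) = E 0 \<longleftrightarrow> c = ?c" for c
  proof
    assume "(\<lambda>v. c *s ((E 0 \<circ> Es 0 \<circ> E 0) v)) = E 0"
    then have "c *s (E 0 (Es 0 (E 0 (x 0)))) = E 0 (x 0)" by (simp add: fun_eq_iff)
    then have "(c * (a * b)) *s x 0 = 1 *s x 0"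
      by (simp add: Ex a b E.lin_scale[OF lin(1)])
    then have "c * (a * b) = 1" using E.x_nonzero[of 0] by (subst (asm) E.scale_cancel_right) simp
    then show "c = ?c" using nz by (simp add: field_simps)
  next
    assume c: "c = ?c"
    show "(\<lambda>v. c *s ((E 0 \<circ> Es 0 \<circ> E 0) v)) = E 0"
    proof
      fix v
      obtain t where "E 0 v = t *s x 0" using E.E_range by blast
      then show "c *s ((E 0 \<circ> Es 0 \<circ> E 0) v) = E 0 v"
        using nz c by (simp add: a b E.lin_scale[OF lin(1)] E.lin_scale[OF lin(2)] field_simps)
    qed
  qed
  have 2: "(\<lambda>v. ?c *s ((Es 0 \<circ> E 0 \<circ> Es 0) v)) = Es 0"
  proof
    fix v
    obtain t where "Es 0 v = t *s xs 0" using Es.E_range by blast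
    then show "?c *s ((Es 0 \<circ> E 0 \<circ> Es 0) v) = Es 0 v"
      using nz by (simp add: a b E.lin_scale[OF lin(1)] E.lin_scale[OF lin(2)] field_simps)
  qed
  have \<nu>: "\<nu> = ?c"
    unfolding \<nu>_def nu_scalar_def by (rule the_equality) (use 1 2 nz in auto)
  then show "\<nu> \<noteq> 0" and "\<nu> *s Es 0 (E 0 (xs 0)) = xs 0"
    using nz by (auto simp: a b E.lin_scale[OF lin(2)] field_simps)
  show "nu_scalar scale (Es 0) (E 0) = \<nu>"
    by (simp add: \<nu>_def nu_scalar_def conj_commute)
qed

text \<open>Conjugating by \<open>T\<close> turns \<open>W E\<^sub>0\<^sup>*\<close> into \<open>W\<^sup>* E\<^sub>0\<close>, so both have the same trace.\<close>

lemma trace_W_Es0: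
  shows "Es 0 (W (xs 0)) = lin_trace scale (W \<circ> Es 0) *s xs 0"
    and "lin_trace scale (Ws \<circ> E 0) = lin_trace scale (W \<circ> Es 0)"
proof -
  interpret S: spin_configuration scale d Es xs E x As A Ws W T f \<tau> by (rule swapped)
  obtain g where g: "Es 0 (W (xs 0)) = g *s xs 0" using Es.E_range by blast
  then have tr: "lin_trace scale (W \<circ> Es 0) = g"
    using Es.trace_rank_one[OF W_lin] by simp
  then show "Es 0 (W (xs 0)) = lin_trace scale (W \<circ> Es 0) *s xs 0" using g by simp
  have "T (xs 0) = E 0 (T (xs 0))" using T_Es0[of "xs 0"] by (simp add: Es.E_x)
  then obtain s where s: "T (xs 0) = s *s x 0" using E.E_range[of 0 "T (xs 0)"] by auto
  have "s \<noteq> 0"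
    using T_inj[of "xs 0" 0] s E.lin_0[OF T_lin] Es.x_nonzero[of 0] by auto
  have "E 0 (Ws (T (xs 0))) = T (Es 0 (W (xs 0)))"
    by (simp add: T_Es0 T_commutes_W)
  then have "s *s E 0 (Ws (x 0)) = s *s (g *s x 0)"
    using g by (simp add: s E.lin_scale[OF S.W_lin] E.lin_scale[OF T_lin] E.lin_scale[OF E.E_lin]
        mult.commute)
  then have "E 0 (Ws (x 0)) = g *s x 0" using \<open>s \<noteq> 0\<close> by (simp only: E.scale_left_imp_eq)
  then show "lin_trace scale (Ws \<circ> E 0) = lin_trace scale (W \<circ> Es 0)"
    using E.trace_rank_one[OF S.W_lin] tr by simp
qed

lemma Ws_sum_inverse: "Ws (\<Sum>i\<le>d. inverse (\<tau> i) *s Es i u) = f *s u"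
proof -
  interpret S: spin_configuration scale d Es xs E x As A Ws W T f \<tau> by (rule swapped)
  have "Ws (\<Sum>i\<le>d. inverse (\<tau> i) *s Es i u) = (\<Sum>i\<le>d. f *s Es i u)"
    unfolding E.lin_sum[OF S.W_lin]
    by (rule sum.cong) (simp_all add: E.lin_scale[OF S.W_lin] S.W_E \<tau>_nonzero)
  then show ?thesis by (simp add: E.scale_sum_right[symmetric] Es.E_sum)
qed

text \<open>Since \<open>T E\<^sub>0\<^sup>* = E\<^sub>0 T\<close>, the operators \<open>T E\<^sub>0\<^sup>*\<close> and \<open>E\<^sub>0 E\<^sub>0\<^sup>*\<close> are
  proportional. The factor comes from projecting
  \<open>T x\<^sub>0\<^sup>* = W\<^sup>* W W\<^sup>* x\<^sub>0\<^sup>*\<close> back to \<open>x\<^sub>0\<^sup>*\<close>.\<close>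

lemma T_xs0:
  defines "\<nu> \<equiv> nu_scalar scale (E 0) (Es 0)"
    and "\<gamma> \<equiv> inverse f * lin_trace scale (Ws \<circ> E 0)"
  shows "T (xs 0) = (\<nu> * f ^ 3 * \<gamma>) *s E 0 (xs 0)" and "\<gamma> \<noteq> 0"
proof -
  interpret S: spin_configuration scale d Es xs E x As A Ws W T f \<tau> by (rule swapped)
  have \<nu>: "\<nu> \<noteq> 0" "\<nu> *s Es 0 (E 0 (xs 0)) = xs 0"
    using nu_nonzero_and_E0_Es0 by (simp_all add: \<nu>_def)
  have g: "Es 0 (W (xs 0)) = (f * \<gamma>) *s xs 0"
    using trace_W_Es0 f_nonzero by (simp add: \<gamma>_def)
  have Es0: "E.lin (Es 0)" by (simp add: Es.E_lin)
  obtain b where b: "E 0 (xs 0) = b *s x 0" using E.E_range by blast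
  have "T (xs 0) = E 0 (T (xs 0))" using T_Es0[of "xs 0"] by (simp add: Es.E_x)
  then obtain s where s: "T (xs 0) = s *s x 0" using E.E_range[of 0 "T (xs 0)"] by auto
  define c where "c = s / b"
  have c: "T (xs 0) = c *s E 0 (xs 0)"
    using b s E0_xs0_nonzero by (auto simp: c_def)
  have Ws_xs: "Ws (xs 0) = f *s xs 0" using S.W_E[of 0 "xs 0"] by (simp add: Es.E_x \<tau>_0)
  have "Es 0 (T (xs 0)) = (f ^ 3 * \<gamma>) *s xs 0"
    unfolding T_Ws[symmetric] S.E0_W Ws_xs
    by (simp add: E.lin_scale[OF W_lin] E.lin_scale[OF Es0] g power3_eq_cube mult_ac)
  then have "\<nu> *s (c *s Es 0 (E 0 (xs 0))) = (\<nu> * f ^ 3 * \<gamma>) *s xs 0"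
    by (simp add: c E.lin_scale[OF Es0] mult_ac)
  then have "c *s xs 0 = (\<nu> * f ^ 3 * \<gamma>) *s xs 0"
    using \<nu>(2) by (metis E.scale_left_commute)
  then have "c = \<nu> * f ^ 3 * \<gamma>" using Es.x_nonzero[of 0] by simp
  then show T: "T (xs 0) = (\<nu> * f ^ 3 * \<gamma>) *s E 0 (xs 0)" using c by simp
  then show "\<gamma> \<noteq> 0"
    using T_inj[of "xs 0" 0] E.lin_0[OF T_lin] Es.x_nonzero[of 0] by auto
qed

text \<open>Everything here commutes with \<open>A\<close>, so it suffices to compare values at the cyclic vector
  \<open>x\<^sub>0\<^sup>*\<close>, where \<open>\<rho>\<^sup>*(E\<^sub>i\<^sup>*)\<close> takes the value \<open>E\<^sub>i\<^sup>* E\<^sub>0 x\<^sub>0\<^sup>*\<close>. The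
  weighted sums become \<open>(W\<^sup>*)\<^sup>-\<^sup>1\<close> or \<open>W\<^sup>*\<close> applied to \<open>E\<^sub>0 x\<^sub>0\<^sup>*\<close>;
  multiplying by \<open>W\<^sup>*\<close> or \<open>W\<close> leaves two statements about \<open>T\<close>.\<close>

lemma W_expansion:
  defines "\<nu> \<equiv> nu_scalar scale (E 0) (Es 0)"
    and "\<gamma> \<equiv> inverse f * lin_trace scale (Ws \<circ> E 0)"
  assumes Ai: "\<And>i. i \<le> d \<Longrightarrow> Ai i = (\<lambda>v. \<nu> *s rho_map scale As A (Es 0) (E 0) (Es i) v)"
  shows "W = (\<lambda>v. (f * \<gamma>) *s (\<Sum>i\<le>d. inverse (\<tau> i) *s Ai i v))"
    and "inv W = (\<lambda>v. (inverse \<nu> * inverse f * inverse \<gamma>) *s (\<Sum>i\<le>d. \<tau> i *s Ai i v))"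
proof -
  interpret S: spin_configuration scale d Es xs E x As A Ws W T f \<tau> by (rule swapped)
  note T = T_xs0[folded \<nu>_def \<gamma>_def]
  have \<nu>: "\<nu> \<noteq> 0" "\<nu> *s Es 0 (E 0 (xs 0)) = xs 0"
    using nu_nonzero_and_E0_Es0 by (simp_all add: \<nu>_def)
  define u where "u = E 0 (xs 0)"
  have rho: "rho_map scale As A (Es 0) (E 0) (Es i) \<in> E.alg A"
      "rho_map scale As A (Es 0) (E 0) (Es i) (xs 0) = Es i u" if "i \<le> d" for i
    using E.rho_map_cyclic[OF As_lin A_lin E.E_lin cycs _ Es.E_range S.E_in_alg[OF that]]
    by (simp_all add: Es.E_x u_def)
  have Ai_alg: "Ai i \<in> E.alg A" if "i \<le> d" for i
    using rho(1)[OF that] gen_subalgebra.scale by (simp add: Ai that)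
  have Ai_xs: "Ai i (xs 0) = \<nu> *s Es i u" if "i \<le> d" for i
    using rho(2) that by (simp add: Ai)
  have sum_lin: "E.lin (\<lambda>v. c *s (\<Sum>i\<le>d. s i *s Ai i v))" for c s
    unfolding E.lin_iff
    by (simp add: E.lin_add[OF E.lin_alg[OF A_lin Ai_alg]] E.lin_scale[OF E.lin_alg[OF A_lin Ai_alg]]
        E.scale_right_distrib sum.distrib E.scale_sum_right mult_ac)
  have sum_A: "(\<lambda>v. c *s (\<Sum>i\<le>d. s i *s Ai i v)) \<circ> A = A \<circ> (\<lambda>v. c *s (\<Sum>i\<le>d. s i *s Ai i v))"
    for c s
    using E.alg_commutes_gen[OF A_lin Ai_alg]
    by (simp add: fun_eq_iff E.lin_scale[OF A_lin] E.lin_sum[OF A_lin])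
  have sum_xs: "(\<Sum>i\<le>d. s i *s Ai i (xs 0)) = \<nu> *s (\<Sum>i\<le>d. s i *s Es i u)" for s
    by (simp add: Ai_xs E.scale_sum_right E.scale_left_commute mult_ac)
  have Ws_xs: "Ws (xs 0) = f *s xs 0" using S.W_E[of 0 "xs 0"] by (simp add: Es.E_x \<tau>_0)
  have W_u: "W u = f *s u" using W_E[of 0 "xs 0"] by (simp add: u_def \<tau>_0)
  show "W = (\<lambda>v. (f * \<gamma>) *s (\<Sum>i\<le>d. inverse (\<tau> i) *s Ai i v))"
  proof (rule E.eq_if_eq_on_cyclic_vector[OF cycs W_lin W_A sum_lin sum_A])
    have "f *s Ws (W (xs 0)) = T (xs 0)"
      by (simp add: T_Ws[symmetric] Ws_xs E.lin_scale[OF W_lin] E.lin_scale[OF S.W_lin])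
    also have "\<dots> = f *s ((f * \<gamma> * \<nu>) *s (f *s u))"
      using T(1) by (simp add: u_def power3_eq_cube mult_ac)
    finally have "Ws (W (xs 0)) = (f * \<gamma> * \<nu>) *s (f *s u)"
      using f_nonzero by (simp only: E.scale_left_imp_eq)
    also have "\<dots> = Ws ((f * \<gamma>) *s (\<Sum>i\<le>d. inverse (\<tau> i) *s Ai i (xs 0)))"
      unfolding sum_xs by (simp add: E.lin_scale[OF S.W_lin] Ws_sum_inverse)
    finally show "W (xs 0) = (f * \<gamma>) *s (\<Sum>i\<le>d. inverse (\<tau> i) *s Ai i (xs 0))"
      by (rule injD[OF bij_is_inj[OF Ws_bij]])
  qed
  have invW_lin: "E.lin (inv W)" using W_lin W_bij by (rule E.lin_inv)
  have invW_A: "inv W \<circ> A = A \<circ> inv W"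
  proof
    fix v
    have "W (A (inv W v)) = A v"
      using fun_cong[OF W_A, of "inv W v"] by (simp add: surj_f_inv_f bij_is_surj W_bij)
    then show "(inv W \<circ> A) v = (A \<circ> inv W) v"
      by (metis W_bij bij_inv_eq_iff comp_apply)
  qed
  show "inv W = (\<lambda>v. (inverse \<nu> * inverse f * inverse \<gamma>) *s (\<Sum>i\<le>d. \<tau> i *s Ai i v))"
  proof (rule E.eq_if_eq_on_cyclic_vector[OF cycs invW_lin invW_A sum_lin sum_A])
    let ?r = "(inverse \<nu> * inverse f * inverse \<gamma>) *s (\<Sum>i\<le>d. \<tau> i *s Ai i (xs 0))"
    have "f *s (\<Sum>i\<le>d. \<tau> i *s Es i u) = Ws u" by (simp add: Ws_eq)
    then have sum: "(\<Sum>i\<le>d. \<tau> i *s Es i u) = inverse f *s Ws u"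
      using f_nonzero by (metis E.scale_one E.scale_scale left_inverse)
    have r: "?r = inverse (f * f * \<gamma>) *s Ws u"
      unfolding sum_xs sum using \<nu>(1) by (simp add: mult_ac)
    have "f *s W (Ws u) = T u"
      by (simp add: T_W[symmetric] W_u E.lin_scale[OF W_lin] E.lin_scale[OF S.W_lin])
    also have "\<dots> = Es 0 (T (xs 0))" by (simp add: u_def T_E0)
    also have "\<dots> = (f ^ 3 * \<gamma>) *s (\<nu> *s Es 0 u)"
      using T(1) by (simp add: u_def E.lin_scale[OF Es.E_lin] mult_ac)
    also have "\<dots> = f *s ((f * f * \<gamma>) *s xs 0)"
      using \<nu>(2) by (simp add: u_def power3_eq_cube mult_ac)
    finally have "W (Ws u) = (f * f * \<gamma>) *s xs 0"
      using f_nonzero by (simp only: E.scale_left_imp_eq)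
    then have "W ?r = xs 0"
      unfolding r using f_nonzero T(2) by (simp add: E.lin_scale[OF W_lin] field_simps)
    then show "inv W (xs 0) = ?r"
      using W_bij by (metis bij_inv_eq_iff)
  qed
qed

end

section \<open>Balanced Boltzmann pairs\<close>

context operator_algebra
begin

text \<open>Passing to adjoints reverses the products in \<open>W\<^sup>* W A\<^sup>* = A W\<^sup>* W\<close>, since the
  elements of both subalgebras are self-adjoint for an invariant form.\<close>

lemma boltzmann_transpose:
  fixes F :: "'v \<Rightarrow> 'v \<Rightarrow> 'f"
  assumes F_add: "\<And>u v w. F (u + v) w = F u w + F v w" "\<And>u v w. F w (u + v) = F w u + F w v"
    and F_scale: "\<And>c u v. F (c *s u) v = c * F u v" "\<And>c u v. F u (c *s v) = c * F u v"
    and nondeg: "\<And>u v. (\<And>w. F w u = F w v) \<Longrightarrow> u = v"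
    and adj: "\<And>u v. F (A u) v = F u (A v)" "\<And>u v. F (As u) v = F u (As v)"
    and lin: "lin A" "lin As" and W: "W \<in> alg A" and Ws: "Ws \<in> alg As"
    and eq: "\<And>v. Ws (W (As v)) = A (Ws (W v))"
  shows "As (W (Ws v)) = W (Ws (A v))"
proof -
  have adj_alg: "\<forall>u v. F (X u) v = F u (X v)"
    if X: "X \<in> alg B" and B: "\<And>u v. F (B u) v = F u (B v)" "lin B" for X B
    using X
  proof (induction rule: gen_subalgebra.induct)
    case (mult X Y)
    then show ?case using fun_cong[OF alg_commutes[OF B(2) mult.hyps]] by simp
  qed (simp_all add: F_add F_scale B)
  have W_adj: "F (W u) v = F u (W v)" and Ws_adj: "F (Ws u) v = F u (Ws v)" for u v
    using adj_alg[OF W adj(1) lin(1)] adj_alg[OF Ws adj(2) lin(2)] by blast+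
  show ?thesis
  proof (rule nondeg)
    fix w
    have "F w (As (W (Ws v))) = F (Ws (W (As w))) v" by (simp add: W_adj Ws_adj adj)
    also have "\<dots> = F w (W (Ws (A v)))" by (simp add: eq W_adj Ws_adj adj)
    finally show "F w (As (W (Ws v))) = F w (W (Ws (A v)))" .
  qed
qed

text \<open>The Boltzmann relation itself gives \<open>T A\<^sup>* = A T\<close>, and its transpose \<open>T A = A\<^sup>* T\<close>. Hence
  \<open>T\<^sup>2\<close> commutes with \<open>A\<close> and with the \<open>E\<^sub>i\<close>, so that \<open>E\<^sub>i\<^sup>* = T\<^sup>-\<^sup>1 E\<^sub>i T\<close> also
  equals \<open>T E\<^sub>i T\<^sup>-\<^sup>1\<close>. With \<open>x\<^sub>i\<^sup>* = T\<^sup>-\<^sup>1 x\<^sub>i\<close> everything known about \<open>x\<^sub>i\<close> is carried over.\<close>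

lemma spin_configuration_exists:
  assumes leonard: "leonard_pair scale d A As" and boltz: "boltzmann_pair scale A As W Ws"
    and bal: "balanced W Ws" and std: "standard_ordering scale d A As E"
    and Es: "\<And>i. i \<le> d \<Longrightarrow> Es i = inv (W \<circ> Ws \<circ> W) \<circ> E i \<circ> (W \<circ> Ws \<circ> W)"
    and f: "f \<noteq> 0" and \<tau>: "\<And>i. i \<le> d \<Longrightarrow> \<tau> i \<noteq> 0" "\<tau> 0 = 1"
    and W_eq: "W = (\<lambda>v. f *s (\<Sum>i\<le>d. \<tau> i *s E i v))"
    and Ws_eq: "Ws = (\<lambda>v. f *s (\<Sum>i\<le>d. \<tau> i *s Es i v))"
  shows "\<exists>x xs. spin_configuration scale d E x Es xs A As W Ws (W \<circ> Ws \<circ> W) f \<tau>"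
proof -
  define T where "T = W \<circ> Ws \<circ> W"
  have lin: "lin A" "lin As" using leonard by (simp_all add: leonard_pair_def)
  have W: "W \<in> alg A" "bij W" and Ws: "Ws \<in> alg As" "bij Ws"
    and conj: "W \<circ> As \<circ> inv W = inv Ws \<circ> A \<circ> Ws"
    using boltz by (simp_all add: boltzmann_pair_def)
  have T_W: "W (Ws (W v)) = T v" for v by (simp add: T_def)
  have T_Ws: "Ws (W (Ws v)) = T v" for v
    using bal by (simp add: T_def balanced_def fun_eq_iff)
  have W_A: "W (A v) = A (W v)" for v
    using fun_cong[OF alg_commutes_gen[OF lin(1) W(1)]] by simp
  have Ws_As: "Ws (As v) = As (Ws v)" for v
    using fun_cong[OF alg_commutes_gen[OF lin(2) Ws(1)]] by simp
  have T_bij: "bij T" unfolding T_def using W(2) Ws(2) by (simp add: bij_comp)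
  have T_lin: "lin T"
    unfolding T_def using lin_alg[OF lin(1) W(1)] lin_alg[OF lin(2) Ws(1)] by (simp add: lin_comp)
  define S where "S = inv T"
  have S_lin: "lin S" unfolding S_def using T_lin T_bij by (rule lin_inv)
  have ST: "S (T v) = v" and TS: "T (S v) = v" for v
    using T_bij by (simp_all add: S_def bij_is_inj bij_is_surj surj_f_inv_f)

  have boltz_eq: "Ws (W (As v)) = A (Ws (W v))" for v
  proof -
    have "W (As v) = inv Ws (A (Ws (W v)))"
      using fun_cong[OF conj, of "W v"] by (simp add: bij_is_inj[OF W(2)])
    then show ?thesis by (simp add: surj_f_inv_f bij_is_surj Ws(2))
  qed
  obtain x \<theta> where res: "rank_one_resolution scale d E x"
    and eig: "\<And>i. i \<le> d \<Longrightarrow> A (x i) = \<theta> i *s x i"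
    and tri: "irreducible_tridiagonal d (matrix_wrt scale d x As)"
    and proj: "\<And>i j v. i \<le> d \<Longrightarrow> j \<le> d \<Longrightarrow> A v = \<theta> j *s v \<Longrightarrow> E i v = (if i = j then v else 0)"
    using standard_ordering_eigenbasis[OF leonard std] by blast
  interpret R: rank_one_resolution scale d E x by (rule res)
  obtain F :: "'v \<Rightarrow> 'v \<Rightarrow> 'f"
    where F: "\<And>u v w. F (u + v) w = F u w + F v w" "\<And>u v w. F w (u + v) = F w u + F w v"
      "\<And>c u v. F (c *s u) v = c * F u v" "\<And>c u v. F u (c *s v) = c * F u v"
      "\<And>u v. (\<And>w. F w u = F w v) \<Longrightarrow> u = v"
      "\<And>u v. F (A u) v = F u (A v)" "\<And>u v. F (As u) v = F u (As v)"
    using R.exists_invariant_form[OF lin(2) tri lin(1) eig] by blast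
  have boltz_eq': "As (W (Ws v)) = W (Ws (A v))" for v
    by (rule boltzmann_transpose[where F = F, OF F lin W(1) Ws(1) boltz_eq])
  have TAs: "T (As v) = A (T v)" for v
    by (simp add: T_W[symmetric] boltz_eq W_A)
  have TA: "T (A v) = As (T v)" for v
    by (simp add: T_W[symmetric] W_A boltz_eq')
  have SA: "S (A v) = As (S v)" and SAs: "S (As v) = A (S v)" for v
    using TAs[of "S v"] TA[of "S v"] by (metis ST TS)+

  have E_commute: "E i (X v) = X (E i v)"
    if i: "i \<le> d" and X: "lin X" "\<And>v. X (A v) = A (X v)" for i X v
  proof -
    have "E i (X (x j)) = X (E i (x j))" if j: "j \<le> d" for j
    proof -
      have "A (X (x j)) = \<theta> j *s X (x j)" using X eig[OF j] by (metis lin_scale)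
      then show ?thesis using proj[OF i j] R.E_x[OF i j] lin_0[OF X(1)] by simp
    qed
    then have "E i (X (\<Sum>j\<le>d. R.coord j v *s x j)) = X (E i (\<Sum>j\<le>d. R.coord j v *s x j))"
      by (simp add: lin_sum[OF X(1)] lin_sum[OF R.E_lin[OF i]] lin_scale[OF X(1)]
          lin_scale[OF R.E_lin[OF i]])
    then show ?thesis by (simp add: R.sum_coord)
  qed
  have E_A: "E i (A v) = A (E i v)" if "i \<le> d" for i v
    using E_commute[OF that lin(1) refl] .
  have Es_S: "Es i v = S (E i (T v))" if "i \<le> d" for i v
    by (simp add: Es[OF that] S_def T_def)
  have T_Es: "T (Es i v) = E i (T v)" if "i \<le> d" for i v
    by (simp add: Es_S[OF that] TS)
  have T_E: "T (E i v) = Es i (T v)" if "i \<le> d" for i v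
  proof -
    have "E i (T (T v)) = T (T (E i v))"
      using E_commute[OF that lin_comp[OF T_lin T_lin], of v] by (simp add: TA TAs)
    then show ?thesis by (simp add: Es_S[OF that] ST)
  qed

  define xs where "xs i = S (x i)" for i
  have res': "rank_one_resolution scale d Es xs"
  proof (intro rank_one_resolution.intro rank_one_resolution_axioms.intro, goal_cases)
    case 1 show ?case by (rule operator_algebra_axioms)
  next
    case (2 i)
    have "Es i = S \<circ> (E i \<circ> T)" using Es_S[OF 2] by (simp add: fun_eq_iff)
    then show ?case using S_lin R.E_lin[OF 2] T_lin by (simp add: lin_comp)
  next
    case (3 i j)
    then show ?case by (simp add: Es_S xs_def TS R.E_x lin_0[OF S_lin])
  next
    case (4 i)
    then show ?case using R.x_nonzero[OF 4] TS[of "x i"] lin_0[OF T_lin] by (auto simp: xs_def)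
  next
    case (5 i v)
    then show ?case
      using R.E_range[OF 5, of "T v"] by (auto simp: Es_S xs_def lin_scale[OF S_lin])
  next
    case (6 v)
    have "(\<Sum>i\<le>d. Es i v) = S (\<Sum>i\<le>d. E i (T v))"
      by (simp add: lin_sum[OF S_lin] Es_S)
    then show ?case by (simp add: R.E_sum ST)
  qed

  have cyc: "cyclic_vector As (x 0)"
    using R.cyclic_if_irreducible_tridiagonal[OF lin(2) tri] .
  (* Conjugation by T maps the algebra of As into that of A, so S carries the cyclic vector over. *)
  have transport: "\<exists>Y\<in>alg A. \<forall>v. Y (S v) = S (Z v)" if "Z \<in> alg As" for Z
    using that
  proof (induction rule: gen_subalgebra.induct)
    case gen
    show ?case by (rule bexI[of _ A]) (simp_all add: SAs gen_subalgebra.gen)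
  next
    case one
    show ?case by (rule bexI[of _ id]) (simp_all add: gen_subalgebra.one)
  next
    case (add X Y)
    then obtain X' Y' where "X' \<in> alg A" "\<forall>v. X' (S v) = S (X v)"
      "Y' \<in> alg A" "\<forall>v. Y' (S v) = S (Y v)" by blast
    then show ?case
      by (intro bexI[of _ "\<lambda>v. X' v + Y' v"]) (simp_all add: lin_add[OF S_lin] gen_subalgebra.add)
  next
    case (scale X c)
    then obtain X' where "X' \<in> alg A" "\<forall>v. X' (S v) = S (X v)" by blast
    then show ?case
      by (intro bexI[of _ "\<lambda>v. c *s X' v"]) (simp_all add: lin_scale[OF S_lin] gen_subalgebra.scale)
  next
    case (mult X Y)
    then obtain X' Y' where "X' \<in> alg A" "\<forall>v. X' (S v) = S (X v)"
      "Y' \<in> alg A" "\<forall>v. Y' (S v) = S (Y v)" by blast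
    then show ?case
      by (intro bexI[of _ "X' \<circ> Y'"]) (simp_all add: gen_subalgebra.mult)
  qed
  have cycs: "cyclic_vector A (xs 0)"
    unfolding cyclic_vector_def
  proof
    fix v
    obtain Z where Z: "Z \<in> alg As" "Z (x 0) = T v"
      using cyc unfolding cyclic_vector_def by blast
    then obtain Y where "Y \<in> alg A" "Y (S (x 0)) = S (T v)" using transport by metis
    then show "\<exists>Y\<in>alg A. Y (xs 0) = v" by (auto simp: xs_def ST)
  qed
  have "spin_configuration scale d E x Es xs A As W Ws T f \<tau>"
  proof (intro spin_configuration.intro spin_configuration_axioms.intro, goal_cases)
    case 1 show ?case by (rule res)
  next
    case 2 show ?case by (rule res')
  next
    case (5 i) then show ?case by (simp add: fun_eq_iff E_A)
  next
    case (6 i) then show ?case by (simp add: fun_eq_iff Es_S TAs E_A SA TA)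
  next
    case (12 v) show ?case by (rule fun_cong[OF W_eq])
  next
    case (13 v) show ?case by (rule fun_cong[OF Ws_eq])
  qed (use lin cyc cycs f \<tau> W Ws T_W T_Ws T_E T_Es in simp_all)
  then show ?thesis unfolding T_def by blast
qed

end

section \<open>Expansions of the Boltzmann pair\<close>

theorem theorem5p25:
  fixes scale :: "'f::field \<Rightarrow> 'v::ab_group_add \<Rightarrow> 'v" (infixr "*s" 75)
    and d :: nat
    and A As W Ws :: "'v \<Rightarrow> 'v"
    and E Es Ai Ais :: "nat \<Rightarrow> 'v \<Rightarrow> 'v"
    and \<rho> \<rho>s :: "('v \<Rightarrow> 'v) \<Rightarrow> ('v \<Rightarrow> 'v)"
    and f \<nu> \<gamma> :: 'f
    and \<tau> :: "nat \<Rightarrow> 'f"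
  assumes "vector_space scale"
    and "vector_space.dim scale (UNIV :: 'v set) = d + 1"
    and "spin_leonard_pair scale d A As"
    and "boltzmann_pair scale A As W Ws"
    and "balanced W Ws"
    and "standard_ordering scale d A As E"
    and "\<And>i. i \<le> d \<Longrightarrow> Es i = inv (W \<circ> Ws \<circ> W) \<circ> E i \<circ> (W \<circ> Ws \<circ> W)"
    and "f \<noteq> 0" and "\<And>i. i \<le> d \<Longrightarrow> \<tau> i \<noteq> 0" and "\<tau> 0 = 1"
    and "W = (\<lambda>v. f *s (\<Sum>i\<le>d. \<tau> i *s E i v))"
    and "Ws = (\<lambda>v. f *s (\<Sum>i\<le>d. \<tau> i *s Es i v))"
    and "\<nu> = nu_scalar scale (E 0) (Es 0)"
    and "\<gamma> = inverse f * lin_trace scale (Ws \<circ> E 0)"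
    and "\<rho> = rho_map scale A As (E 0) (Es 0)"
    and "\<rho>s = rho_map scale As A (Es 0) (E 0)"
    and "\<And>i. i \<le> d \<Longrightarrow> Ai i = (\<lambda>v. \<nu> *s \<rho>s (Es i) v)"
    and "\<And>i. i \<le> d \<Longrightarrow> Ais i = (\<lambda>v. \<nu> *s \<rho> (E i) v)"
  shows "\<nu> \<noteq> 0 \<and> \<gamma> \<noteq> 0 \<and>
    W = (\<lambda>v. (f * \<gamma>) *s (\<Sum>i\<le>d. inverse (\<tau> i) *s Ai i v)) \<and>
    inv W = (\<lambda>v. (inverse \<nu> * inverse f * inverse \<gamma>) *s (\<Sum>i\<le>d. \<tau> i *s Ai i v)) \<and>
    Ws = (\<lambda>v. (f * \<gamma>) *s (\<Sum>i\<le>d. inverse (\<tau> i) *s Ais i v)) \<and>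
    inv Ws = (\<lambda>v. (inverse \<nu> * inverse f * inverse \<gamma>) *s (\<Sum>i\<le>d. \<tau> i *s Ais i v))"
proof -
  interpret operator_algebra scale using assms(1) by (simp add: operator_algebra_def)
  have "leonard_pair scale d A As" using assms(3) by (simp add: spin_leonard_pair_def)
  then obtain x xs where
    conf: "spin_configuration scale d E x Es xs A As W Ws (W \<circ> Ws \<circ> W) f \<tau>"
    using spin_configuration_exists[OF _ assms(4-12)] by blast
  interpret C: spin_configuration scale d E x Es xs A As W Ws "W \<circ> Ws \<circ> W" f \<tau> by (rule conf)
  interpret D: spin_configuration scale d Es xs E x As A Ws W "W \<circ> Ws \<circ> W" f \<tau> by (rule C.swapped)
  have \<nu>: "\<nu> \<noteq> 0" "\<nu> = nu_scalar scale (Es 0) (E 0)"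
    using C.nu_nonzero_and_E0_Es0 by (simp_all add: assms(13))
  have \<gamma>: "\<gamma> \<noteq> 0" "\<gamma> = inverse f * lin_trace scale (W \<circ> Es 0)"
    using C.T_xs0(2) C.trace_W_Es0(2) by (simp_all add: assms(14))
  show ?thesis
    using \<nu>(1) \<gamma>(1) C.W_expansion[of Ai, folded assms(13,14,16), OF assms(17)]
      D.W_expansion[of Ais, folded \<nu>(2) \<gamma>(2) assms(15), OF assms(18)]
    by (intro conjI)
qed

end
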